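(* Let $\alpha=(\alpha_n)_{n\in\mathbb{N}}$ be a non-negative increasing sequence with $\lim_{n\to\infty}\alpha_n=\infty$. Assume that $\alpha$ is stable and that $\Lambda_1(\alpha)$ is nuclear, and let $\beta\in(\Lambda_1(\alpha))'$. Then: (i) The dual convolution operator $\check{T}_\beta:\Lambda_1(\alpha)\to\Lambda_1(\alpha)$ is m-topologizable if and only if for every $p\in\mathbb{N}$ there exist $q\in\mathbb{N}$ and $D_p>0$ such that $|\beta^{*k}_{n-1}|\le D_p^k e^{-\frac1q\alpha_n}$ for every $k,n\in\mathbb{N}$. (ii) $\check{T}_\beta:\Lambda_1(\alpha)\to\Lambda_1(\alpha)$ is power bounded if and only if for every $p\in\mathbb{N}$ there exist $q\in\mathbb{N}$ and $C_p\ge1$ such that $|\beta^{*k}_{n-1}|\le C_p e^{-\frac1q\alpha_n}$ for every $k,n\in\mathbb{N}$.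
   Context: $\mathbb{N}=\{1,2,\dots\}$, $\mathbb{N}_0=\mathbb{N}\cup\{0\}$. The sequence $\alpha$ is stable if $\sup_{n\in\mathbb{N}}\alpha_{2n}/\alpha_n<\infty$. The power series space of finite type is $\Lambda_1(\alpha)=\{x=(x_n)_{n\in\mathbb{N}}:\|x\|_k:=\sum_{n=1}^\infty|x_n|e^{-\frac1k\alpha_n}<\infty\text{ for all }k\in\mathbb{N}\}$, a Fréchet space with the increasing sequence of seminorms $(\|\cdot\|_k)_{k\in\mathbb{N}}$ and canonical basis $(e_n)_{n\in\mathbb{N}}$. It is nuclear if and only if $\lim_{n\to\infty}\frac{\ln n}{\alpha_n}=0$. Its dual is identified with the sequences $\beta=(\beta_n)_{n\in\mathbb{N}_0}$ (indexed from $0$, $\beta_{n-1}$ being the $n$-th coordinate) such that for some $m\in\mathbb{N}$, $C>0$: $|\beta_{n-1}|\le Ce^{-\frac1m\alpha_n}$ for all $n\in\mathbb{N}$. The dual convolution operator $\check{T}_\beta$ is the continuous linear operator on $\Lambda_1(\alpha)$ with $\check{T}_\beta e_n=\sum_{j=1}^n\beta_{n-j}e_j$ and $\check{T}_\beta x=\sum_{n=1}^\infty x_n\check{T}_\beta e_n$ (well-defined and continuous for every $\beta\in(\Lambda_1(\alpha))'$ when $\alpha$ is stable and $\Lambda_1(\alpha)$ is nuclear). Convolution of sequences indexed by $\mathbb{N}_0$: $(\beta*\psi)_m=\sum_{i=0}^m\beta_i\psi_{m-i}$; $\beta^{*k}=\beta*\cdots*\beta$ ($k$ factors), and $\beta^{*k}_{m}$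 is its entry of index $m\in\mathbb{N}_0$. A continuous linear operator $T$ on a Fréchet space $E$ with increasing seminorms $(\|\cdot\|_p)_{p\in\mathbb{N}}$ is m-topologizable if for every $p\in\mathbb{N}$ there exist $q\in\mathbb{N}$ and $C_p\ge1$ with $\|T^kx\|_p\le C_p^k\|x\|_q$ for all $k\in\mathbb{N}$, $x\in E$; it is power bounded if for every $p\in\mathbb{N}$ there exist $q\in\mathbb{N}$ and $C_p\ge1$ with $\|T^kx\|_p\le C_p\|x\|_q$ for all $k\in\mathbb{N}$, $x\in E$. *)

theory Defs
  imports "HOL-Analysis.Analysis"
begin

text \<open>
  The positive integers are the naturals \<open>n \<ge> 1\<close>. A scalar sequence \<open>(x\<^sub>n)\<close> with
  \<open>n = 1, 2, \<dots>\<close> is a function \<open>nat \<Rightarrow> 'a\<close> that vanishes at the unused index \<open>0\<close>,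
  so that equality of functions is equality of sequences. The scalars form a complete normed field
  over the reals with multiplicative norm, which covers the real and the complex numbers.
\<close>


subsection \<open>Spaces of sequences with a family of seminorms\<close>

text \<open>
  In this section \<open>E\<close> is a linear space of sequences whose topology is given by the increasing
  seminorms \<open>P 1 \<le> P 2 \<le> \<dots>\<close>; the index \<open>0\<close> of \<open>P\<close> is not used.
\<close>

definition converges_in ::
  "(nat \<Rightarrow> 'a::{real_normed_field,banach}) set \<Rightarrow> (nat \<Rightarrow> (nat \<Rightarrow> 'a) \<Rightarrow> real) \<Rightarrow>
    (nat \<Rightarrow> nat \<Rightarrow> 'a) \<Rightarrow> (nat \<Rightarrow> 'a) \<Rightarrow> bool"
  where "converges_in E P X y \<longleftrightarrow>
    y \<in> E \<and> (\<forall>k\<ge>1. (\<lambda>N. P k (\<lambda>i. X N i - y i)) \<longlonglongrightarrow> 0)"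

definition linear_functional_on ::
  "(nat \<Rightarrow> 'a::{real_normed_field,banach}) set \<Rightarrow> ((nat \<Rightarrow> 'a) \<Rightarrow> 'a) \<Rightarrow> bool"
  where "linear_functional_on E f \<longleftrightarrow>
    (\<forall>x\<in>E. \<forall>y\<in>E. \<forall>a b. f (\<lambda>i. a * x i + b * y i) = a * f x + b * f y)"

definition continuous_linear_operator ::
  "(nat \<Rightarrow> 'a::{real_normed_field,banach}) set \<Rightarrow> (nat \<Rightarrow> (nat \<Rightarrow> 'a) \<Rightarrow> real) \<Rightarrow>
    ((nat \<Rightarrow> 'a) \<Rightarrow> (nat \<Rightarrow> 'a)) \<Rightarrow> bool"
  where "continuous_linear_operator E P T \<longleftrightarrow>
    (\<forall>x\<in>E. T x \<in> E) \<and>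
    (\<forall>x\<in>E. \<forall>y\<in>E. \<forall>a b. T (\<lambda>i. a * x i + b * y i) = (\<lambda>i. a * T x i + b * T y i)) \<and>
    (\<forall>x\<in>E. \<forall>p\<ge>1. \<forall>\<epsilon>>0. \<exists>q\<ge>1. \<exists>\<delta>>0. \<forall>y\<in>E.
       P q (\<lambda>i. y i - x i) < \<delta> \<longrightarrow> P p (\<lambda>i. T y i - T x i) < \<epsilon>)"

text \<open>
  \<open>E\<close> is nuclear if for every \<open>p\<close> there is \<open>q \<ge> p\<close> such that the canonical map between the local
  Banach spaces of \<open>P q\<close> and \<open>P p\<close> is nuclear, that is, of the form
  \<open>x \<mapsto> \<Sum>j. f\<^sub>j(x) y\<^sub>j\<close> with \<open>\<Sum>j. \<parallel>f\<^sub>j\<parallel> \<parallel>y\<^sub>j\<parallel> < \<infinity>\<close>. Here \<open>a j\<close> bounds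
  the dual norm of \<open>f j\<close>. The completions need not be formed: the \<open>f j\<close> and the identity between
  bounded maps are determined on the dense image of \<open>E\<close>, and the \<open>y j\<close> may be taken in \<open>E\<close>
  because every element \<open>y\<close> of a completion is, for each \<open>\<epsilon> > 0\<close>, the sum of a series in the dense
  subspace whose norms add up to at most \<open>(1 + \<epsilon>) \<parallel>y\<parallel>\<close>.
\<close>

definition nuclear_space ::
  "(nat \<Rightarrow> 'a::{real_normed_field,banach}) set \<Rightarrow> (nat \<Rightarrow> (nat \<Rightarrow> 'a) \<Rightarrow> real) \<Rightarrow> bool"
  where "nuclear_space E P \<longleftrightarrow>
    (\<forall>p\<ge>1. \<exists>q\<ge>p. \<exists>(f :: nat \<Rightarrow> (nat \<Rightarrow> 'a) \<Rightarrow> 'a) (a :: nat \<Rightarrow> real) (y :: nat \<Rightarrow> nat \<Rightarrow> 'a).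
      (\<forall>j. linear_functional_on E (f j) \<and> 0 \<le> a j \<and> (\<forall>x\<in>E. norm (f j x) \<le> a j * P q x)) \<and>
      (\<forall>j. y j \<in> E) \<and>
      summable (\<lambda>j. a j * P p (y j)) \<and>
      (\<forall>x\<in>E. (\<lambda>N. P p (\<lambda>i. x i - (\<Sum>j<N. f j x * y j i))) \<longlonglongrightarrow> 0))"

definition m_topologizable ::
  "(nat \<Rightarrow> 'a::{real_normed_field,banach}) set \<Rightarrow> (nat \<Rightarrow> (nat \<Rightarrow> 'a) \<Rightarrow> real) \<Rightarrow>
    ((nat \<Rightarrow> 'a) \<Rightarrow> (nat \<Rightarrow> 'a)) \<Rightarrow> bool"
  where "m_topologizable E P T \<longleftrightarrow>
    continuous_linear_operator E P T \<and>
    (\<forall>p\<ge>1. \<exists>q\<ge>1. \<exists>C\<ge>1. \<forall>k\<ge>1. \<forall>x\<in>E. P p ((T ^^ k) x) \<le> C ^ k * P q x)"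

definition power_bounded ::
  "(nat \<Rightarrow> 'a::{real_normed_field,banach}) set \<Rightarrow> (nat \<Rightarrow> (nat \<Rightarrow> 'a) \<Rightarrow> real) \<Rightarrow>
    ((nat \<Rightarrow> 'a) \<Rightarrow> (nat \<Rightarrow> 'a)) \<Rightarrow> bool"
  where "power_bounded E P T \<longleftrightarrow>
    continuous_linear_operator E P T \<and>
    (\<forall>p\<ge>1. \<exists>q\<ge>1. \<exists>C\<ge>1. \<forall>k\<ge>1. \<forall>x\<in>E. P p ((T ^^ k) x) \<le> C * P q x)"


subsection \<open>Power series spaces of finite type\<close>

text \<open>
  Since \<open>r / 0 = 0\<close>, the quotients with \<open>\<alpha> n = 0\<close> do not contribute to the supremum; for
  \<open>\<alpha>\<close> tending to infinity there are only finitely many of them.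
\<close>

definition stable_sequence :: "(nat \<Rightarrow> real) \<Rightarrow> bool"
  where "stable_sequence \<alpha> \<longleftrightarrow> bdd_above ((\<lambda>n. \<alpha> (2 * n) / \<alpha> n) ` {1..})"

definition Lambda1 :: "(nat \<Rightarrow> real) \<Rightarrow> (nat \<Rightarrow> 'a::{real_normed_field,banach}) set"
  where "Lambda1 \<alpha> = {x. x 0 = 0 \<and>
    (\<forall>k\<ge>(1::nat). summable (\<lambda>n. norm (x (Suc n)) * exp (- (1 / real k) * \<alpha> (Suc n))))}"

definition Lambda1_norm ::
  "(nat \<Rightarrow> real) \<Rightarrow> nat \<Rightarrow> (nat \<Rightarrow> 'a::{real_normed_field,banach}) \<Rightarrow> real"
  where "Lambda1_norm \<alpha> k x = (\<Sum>n. norm (x (Suc n)) * exp (- (1 / real k) * \<alpha> (Suc n)))"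

definition canonical_basis :: "nat \<Rightarrow> nat \<Rightarrow> 'a::{real_normed_field,banach}"
  where "canonical_basis n = (\<lambda>i. if i = n then 1 else 0)"

text \<open>
  The dual space, identified with sequences indexed from \<open>0\<close>: the \<open>n\<close>-th coordinate
  (\<open>n \<ge> 1\<close>) of the functional is \<open>\<beta> (n - 1)\<close>.
\<close>

definition Lambda1_dual :: "(nat \<Rightarrow> real) \<Rightarrow> (nat \<Rightarrow> 'a::{real_normed_field,banach}) set"
  where "Lambda1_dual \<alpha> = {\<beta>. \<exists>m\<ge>(1::nat). \<exists>C>0. \<forall>n\<ge>1.
    norm (\<beta> (n - 1)) \<le> C * exp (- (1 / real m) * \<alpha> n)}"


subsection \<open>Dual convolution operators\<close>

definition dual_conv_basis ::
  "(nat \<Rightarrow> 'a::{real_normed_field,banach}) \<Rightarrow> nat \<Rightarrow> (nat \<Rightarrow> 'a)"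
  where "dual_conv_basis \<beta> n = (\<lambda>i. \<Sum>j=1..n. \<beta> (n - j) * canonical_basis j i)"

text \<open>
  The value at \<open>x\<close> is the sum of the series of the \<open>x n\<close>-multiples of the images of the basis
  vectors, in the topology of \<open>Lambda1 \<alpha>\<close>.
\<close>

definition dual_conv ::
  "(nat \<Rightarrow> real) \<Rightarrow> (nat \<Rightarrow> 'a::{real_normed_field,banach}) \<Rightarrow> (nat \<Rightarrow> 'a) \<Rightarrow> (nat \<Rightarrow> 'a)"
  where "dual_conv \<alpha> \<beta> x = (THE y. converges_in (Lambda1 \<alpha>) (Lambda1_norm \<alpha>)
    (\<lambda>N i. \<Sum>n=1..N. x n * dual_conv_basis \<beta> n i) y)"

definition seq_conv ::
  "(nat \<Rightarrow> 'a::{real_normed_field,banach}) \<Rightarrow> (nat \<Rightarrow> 'a) \<Rightarrow> (nat \<Rightarrow> 'a)"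
  where "seq_conv \<beta> \<psi> = (\<lambda>m. \<Sum>i=0..m. \<beta> i * \<psi> (m - i))"

primrec conv_power ::
  "(nat \<Rightarrow> 'a::{real_normed_field,banach}) \<Rightarrow> nat \<Rightarrow> (nat \<Rightarrow> 'a)"
  where
    "conv_power \<beta> 0 = (\<lambda>m. if m = 0 then 1 else 0)"
  | "conv_power \<beta> (Suc k) = seq_conv \<beta> (conv_power \<beta> k)"

end

theory Submission
  imports Defs
begin

text \<open>
  The operator is the adjoint of a convolution: \<open>(T x)\<^sub>i = \<Sum>m. \<beta>\<^sub>m x\<^sub>i\<^sub>+\<^sub>m\<close> for \<open>i \<ge> 1\<close>
  (\<open>conv_adjoint\<close>, \<open>dual_conv_eq_conv_adjoint\<close>). Adjoints of convolutions compose by convolving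
  their symbols (\<open>conv_adjoint_conv_adjoint\<close>), so the \<open>k\<close>-th iterate of \<open>T\<close> is the operator of the
  same kind with symbol \<open>\<beta>\<^sup>*\<^sup>k\<close>. Both equivalences therefore compare, uniformly in \<open>k\<close>, operator
  bounds for \<open>conv_adjoint b\<close> with decay of the symbol \<open>b\<close>.

  From operator bounds to decay: the first coordinate of the image of \<open>e\<^sub>n\<close> is \<open>b (n - 1)\<close>, and
  the norm of \<open>e\<^sub>n\<close> with index \<open>q\<close> is \<open>exp (- \<alpha>\<^sub>n / q)\<close>. Thus a bound of the seminorm with index
  \<open>1\<close> by the one with index \<open>q\<close> is, up to the factor \<open>exp \<alpha>\<^sub>1\<close>, a decay of \<open>b\<close> at rate \<open>1 / q\<close>.

  From decay to operator bounds: the seminorms are weighted \<open>\<ell>\<^sup>1\<close>-norms, so it suffices to estimate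
  the images of the \<open>e\<^sub>n\<close>, that is, the sums of \<open>exp (- \<alpha>\<^sub>i / p) exp (- \<alpha>\<^sub>j / r)\<close> over
  \<open>i + j = n + 1\<close>, by a multiple of \<open>exp (- \<alpha>\<^sub>n / q)\<close> (\<open>triangle_weight_bound\<close>). One of \<open>i\<close> and
  \<open>j\<close> is at least \<open>n / 2\<close>, and stability turns its factor into \<open>exp (- \<alpha>\<^sub>n / q)\<close>; the
  other factor is summable because nuclearity forces \<open>\<Sum>n. exp (- \<alpha>\<^sub>n / r) < \<infinity>\<close> for every \<open>r\<close>
  (\<open>nuclear_Lambda1_summable_weights\<close>). The resulting constant depends on \<open>b\<close> only through a
  factor linear in the constant of its decay, which is what makes the estimate uniform in \<open>k\<close>.
\<close>

section \<open>Summation over triangles\<close>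

text \<open>
  Fubini for double series in the form that convolutions need. The hypothesis is absolute
  convergence along the diagonals \<open>m + l = n\<close>, where the weights can be estimated; the conclusions
  concern the rows, which are the coordinates of the operators below.
\<close>

lemma triangle_sums:
  fixes f :: "nat \<Rightarrow> nat \<Rightarrow> 'a::banach"
  assumes S: "summable (\<lambda>n. \<Sum>m\<le>n. norm (f m (n - m)))"
  shows triangle_sums_row: "summable (\<lambda>l. norm (f m l))"
    and triangle_sums_abs: "summable (\<lambda>m. \<Sum>l. norm (f m l))"
    and triangle_sums_eq: "(\<Sum>m. \<Sum>l. f m l) = (\<Sum>n. \<Sum>m\<le>n. f m (n - m))"
proof -
  define g where "g = (\<lambda>(m, l). f m l)"
  define \<phi> :: "nat \<times> nat \<Rightarrow> nat \<times> nat" where "\<phi> = (\<lambda>(n, m). (m, n - m))"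
  let ?T = "Sigma UNIV (\<lambda>n::nat. {..n})"
  have bij: "bij_betw \<phi> ?T (UNIV \<times> UNIV)"
    by (rule bij_betw_byWitness[where f' = "\<lambda>(m, l). (m + l, m)"]) (auto simp: \<phi>_def)
  have T: "(\<lambda>z. norm (g (\<phi> z))) summable_on ?T"
  proof (rule Infinite_Sum.abs_summable_on_Sigma_iff[THEN iffD2], intro conjI ballI)
    show "(\<lambda>m. norm (g (\<phi> (n, m)))) summable_on {..n}" for n
      by simp
    show "(\<lambda>n. norm (infsum (\<lambda>m. norm (g (\<phi> (n, m)))) {..n})) summable_on UNIV"
      using S by (simp add: g_def \<phi>_def sum_nonneg summable_on_UNIV_nonneg_real_iff)
  qed
  have G: "(\<lambda>z. norm (g z)) summable_on UNIV \<times> UNIV"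
    using T summable_on_reindex_bij_betw[OF bij, of "\<lambda>z. norm (g z)"] by simp
  then have G': "(\<forall>m. (\<lambda>l. norm (f m l)) summable_on UNIV) \<and>
      (\<lambda>m. norm (infsum (\<lambda>l. norm (f m l)) UNIV)) summable_on UNIV"
    unfolding Infinite_Sum.abs_summable_on_Sigma_iff by (simp add: g_def)
  then show row: "summable (\<lambda>l. norm (f m l))" for m
    by (simp add: summable_on_UNIV_nonneg_real_iff)
  have inf: "infsum h UNIV = suminf h" if "summable (\<lambda>n. norm (h n))"
    for h :: "nat \<Rightarrow> 'b::banach"
    by (rule infsumI[OF norm_summable_imp_has_sum[OF that
          summable_sums[OF summable_norm_cancel[OF that]]]])
  have "infsum (\<lambda>l. norm (f m l)) UNIV = (\<Sum>l. norm (f m l))" for m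
    using inf[of "\<lambda>l. norm (f m l)"] row by simp
  with G' show abs: "summable (\<lambda>m. \<Sum>l. norm (f m l))"
    by (simp add: summable_on_UNIV_nonneg_real_iff suminf_nonneg row)
  have "(\<Sum>m. \<Sum>l. f m l) = infsum (\<lambda>m. infsum (\<lambda>l. g (m, l)) UNIV) UNIV"
  proof -
    have "summable (\<lambda>m. norm (\<Sum>l. f m l))"
      by (rule summable_comparison_test'[OF abs, of 0]) (simp add: summable_norm row)
    then show ?thesis
      by (simp add: inf row g_def)
  qed
  also have "\<dots> = infsum g (UNIV \<times> UNIV)"
    by (rule infsum_Sigma_banach[OF abs_summable_summable[OF G]])
  also have "\<dots> = infsum (\<lambda>z. g (\<phi> z)) ?T"
    by (rule infsum_reindex_bij_betw[OF bij, symmetric])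
  also have "\<dots> = infsum (\<lambda>n. infsum (\<lambda>m. g (\<phi> (n, m))) {..n}) UNIV"
    by (rule infsum_Sigma_banach[OF abs_summable_summable[OF T], symmetric])
  also have "\<dots> = (\<Sum>n. \<Sum>m\<le>n. f m (n - m))"
  proof -
    have "summable (\<lambda>n. norm (\<Sum>m\<le>n. f m (n - m)))"
      by (rule summable_comparison_test'[OF S, of 0]) (simp add: norm_sum)
    then show ?thesis
      by (simp add: inf g_def \<phi>_def)
  qed
  finally show "(\<Sum>m. \<Sum>l. f m l) = (\<Sum>n. \<Sum>m\<le>n. f m (n - m))" .
qed


section \<open>The sequence space and its coordinates\<close>

lemma Lambda1_summable:
  "x \<in> Lambda1 \<alpha> \<Longrightarrow> 1 \<le> k \<Longrightarrow>
    summable (\<lambda>n. norm (x (Suc n)) * exp (- (1 / real k) * \<alpha> (Suc n)))"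
  by (simp add: Lambda1_def)

lemma Lambda1_zero: "x \<in> Lambda1 \<alpha> \<Longrightarrow> x 0 = 0"
  by (simp add: Lambda1_def)

lemma Lambda1_lincomb:
  assumes x: "x \<in> Lambda1 \<alpha>" and y: "y \<in> Lambda1 \<alpha>"
  shows "(\<lambda>i. a * x i + b * y i) \<in> Lambda1 \<alpha>"
  unfolding Lambda1_def
proof (intro CollectI conjI allI impI)
  show "a * x 0 + b * y 0 = 0"
    using x y by (simp add: Lambda1_zero)
  fix k :: nat assume k: "1 \<le> k"
  show "summable (\<lambda>n. norm (a * x (Suc n) + b * y (Suc n)) * exp (- (1 / real k) * \<alpha> (Suc n)))"
  proof (rule summable_comparison_test'[where N = 0])
    show "summable (\<lambda>n. norm a * (norm (x (Suc n)) * exp (- (1 / real k) * \<alpha> (Suc n)))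
        + norm b * (norm (y (Suc n)) * exp (- (1 / real k) * \<alpha> (Suc n))))"
      by (intro summable_add summable_mult Lambda1_summable x y k)
    show "norm (norm (a * x (Suc n) + b * y (Suc n)) * exp (- (1 / real k) * \<alpha> (Suc n)))
        \<le> norm a * (norm (x (Suc n)) * exp (- (1 / real k) * \<alpha> (Suc n)))
        + norm b * (norm (y (Suc n)) * exp (- (1 / real k) * \<alpha> (Suc n)))" for n
      using mult_right_mono[OF norm_triangle_ineq[of "a * x (Suc n)" "b * y (Suc n)"],
          of "exp (- (1 / real k) * \<alpha> (Suc n))"]
      by (simp add: norm_mult algebra_simps)
  qed
qed

lemma Lambda1_diff:
  "x \<in> Lambda1 \<alpha> \<Longrightarrow> y \<in> Lambda1 \<alpha> \<Longrightarrow> (\<lambda>i. x i - y i) \<in> Lambda1 \<alpha>"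
  using Lambda1_lincomb[of x \<alpha> y 1 "-1"] by simp

lemma Lambda1_finite_support:
  assumes "x 0 = 0" and "\<And>n. n > N \<Longrightarrow> x n = 0"
  shows "x \<in> Lambda1 \<alpha>"
proof -
  have "summable (\<lambda>n. norm (x (Suc n)) * exp (- (1 / real k) * \<alpha> (Suc n)))" for k
    by (rule summable_finite[where N = "{..<N}"]) (auto simp: assms(2))
  with assms(1) show ?thesis by (simp add: Lambda1_def)
qed

lemma Lambda1_truncation: "(\<lambda>n. if 1 \<le> n \<and> n \<le> N then x n else 0) \<in> Lambda1 \<alpha>"
  by (rule Lambda1_finite_support[where N = N]) auto

lemma Lambda1_sum:
  fixes y :: "nat \<Rightarrow> nat \<Rightarrow> 'a::{real_normed_field,banach}"
  assumes "\<And>j. y j \<in> Lambda1 \<alpha>"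
  shows "(\<lambda>i. \<Sum>j<N. c j * y j i) \<in> Lambda1 \<alpha>"
proof (induction N)
  case 0
  then show ?case by (simp add: Lambda1_def)
next
  case (Suc N)
  from Lambda1_lincomb[OF Suc assms[of N], of 1 "c N"] show ?case by simp
qed

lemma canonical_basis_in_Lambda1: "1 \<le> n \<Longrightarrow> canonical_basis n \<in> Lambda1 \<alpha>"
  by (rule Lambda1_finite_support[where N = n]) (auto simp: canonical_basis_def)

lemma Lambda1_norm_canonical_basis:
  assumes "1 \<le> n"
  shows "Lambda1_norm \<alpha> k (canonical_basis n :: nat \<Rightarrow> 'a::{real_normed_field,banach})
    = exp (- (1 / real k) * \<alpha> n)"
proof -
  from assms obtain n' where n: "n = Suc n'" by (cases n) auto
  have "Lambda1_norm \<alpha> k (canonical_basis n :: nat \<Rightarrow> 'a) = (\<Sum>i\<in>{n'}.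
      norm (canonical_basis n (Suc i) :: 'a) * exp (- (1 / real k) * \<alpha> (Suc i)))"
    unfolding Lambda1_norm_def by (rule suminf_finite) (auto simp: canonical_basis_def n)
  then show ?thesis by (simp add: canonical_basis_def n)
qed

lemma Lambda1_norm_nonneg: "x \<in> Lambda1 \<alpha> \<Longrightarrow> 1 \<le> k \<Longrightarrow> 0 \<le> Lambda1_norm \<alpha> k x"
  unfolding Lambda1_norm_def by (intro suminf_nonneg Lambda1_summable) auto

lemma coordinate_le_Lambda1_norm:
  assumes "x \<in> Lambda1 \<alpha>" and "1 \<le> k" and "1 \<le> n"
  shows "norm (x n) * exp (- (1 / real k) * \<alpha> n) \<le> Lambda1_norm \<alpha> k x"
proof -
  from assms(3) obtain n' where n: "n = Suc n'" by (cases n) auto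
  show ?thesis
    using sum_le_suminf[OF Lambda1_summable[OF assms(1,2)], of "{n'}"]
    by (simp add: n Lambda1_norm_def)
qed

lemma Lambda1_norm_truncation_tendsto:
  fixes x :: "nat \<Rightarrow> 'a::{real_normed_field,banach}"
  assumes x: "x \<in> Lambda1 \<alpha>" and k: "1 \<le> k"
  shows "(\<lambda>N. Lambda1_norm \<alpha> k (\<lambda>n. (if 1 \<le> n \<and> n \<le> N then x n else 0) - x n)) \<longlonglongrightarrow> 0"
proof -
  let ?t = "\<lambda>n. norm (x (Suc n)) * exp (- (1 / real k) * \<alpha> (Suc n))"
  have sm: "summable ?t" by (rule Lambda1_summable[OF x k])
  have "Lambda1_norm \<alpha> k (\<lambda>n. (if 1 \<le> n \<and> n \<le> N then x n else 0) - x n)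
      = suminf ?t - sum ?t {..<N}" for N
  proof -
    let ?d = "\<lambda>n. norm ((if 1 \<le> Suc n \<and> Suc n \<le> N then x (Suc n) else 0) - x (Suc n))
        * exp (- (1 / real k) * \<alpha> (Suc n))"
    have "summable ?d"
      by (rule summable_comparison_test'[OF sm, of 0]) auto
    then have "suminf ?d = (\<Sum>n. ?d (n + N)) + sum ?d {..<N}"
      by (rule suminf_split_initial_segment)
    also have "\<dots> = (\<Sum>n. ?t (n + N))" by simp
    also have "\<dots> = suminf ?t - sum ?t {..<N}"
      by (rule suminf_minus_initial_segment[OF sm])
    finally show ?thesis by (simp add: Lambda1_norm_def)
  qed
  moreover have "(\<lambda>N. suminf ?t - sum ?t {..<N}) \<longlonglongrightarrow> suminf ?t - suminf ?t"
    by (intro tendsto_diff tendsto_const summable_LIMSEQ sm)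
  ultimately show ?thesis by simp
qed

text \<open>
  Coordinates are continuous, so limits are determined coordinate by coordinate; this justifies
  the definite description by which \<open>dual_conv\<close> is defined.
\<close>

lemma converges_in_Lambda1_unique:
  fixes X :: "nat \<Rightarrow> nat \<Rightarrow> 'a::{real_normed_field,banach}"
  assumes X: "\<And>N. X N \<in> Lambda1 \<alpha>"
    and y: "converges_in (Lambda1 \<alpha>) (Lambda1_norm \<alpha>) X y"
    and z: "converges_in (Lambda1 \<alpha>) (Lambda1_norm \<alpha>) X z"
  shows "y = z"
proof
  have coord: "(\<lambda>N. X N n) \<longlonglongrightarrow> v n"
    if v: "converges_in (Lambda1 \<alpha>) (Lambda1_norm \<alpha>) X v" and n: "1 \<le> n" for v n
  proof -
    have vE: "v \<in> Lambda1 \<alpha>" and lim: "(\<lambda>N. Lambda1_norm \<alpha> 1 (\<lambda>i. X N i - v i)) \<longlonglongrightarrow> 0"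
      using v by (auto simp: converges_in_def)
    have "(\<lambda>N. X N n - v n) \<longlonglongrightarrow> 0"
    proof (rule Lim_null_comparison)
      show "\<forall>\<^sub>F N in sequentially.
          norm (X N n - v n) \<le> exp (\<alpha> n) * Lambda1_norm \<alpha> 1 (\<lambda>i. X N i - v i)"
        using coordinate_le_Lambda1_norm[OF Lambda1_diff[OF X vE] order.refl n]
        by (intro always_eventually allI) (simp add: exp_minus field_simps)
      show "(\<lambda>N. exp (\<alpha> n) * Lambda1_norm \<alpha> 1 (\<lambda>i. X N i - v i)) \<longlonglongrightarrow> 0"
        using tendsto_mult_right_zero[OF lim] by simp
    qed
    then show ?thesis by (rule LIM_zero_cancel)
  qed
  fix n
  show "y n = z n"
  proof (cases "n = 0")
    case True
    then show ?thesis using y z by (auto simp: converges_in_def Lambda1_zero)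
  next
    case False
    then show ?thesis using coord[OF y, of n] coord[OF z, of n] LIMSEQ_unique by auto
  qed
qed


section \<open>Nuclearity and summability of the weights\<close>

text \<open>
  The half of the Grothendieck--Pietsch criterion that is needed here, read off from the diagonal of
  a nuclear representation. With \<open>w\<^sub>k(n) = exp (- \<alpha>\<^sub>n / k)\<close>, the \<open>n\<close>-th coordinate of
  \<open>e\<^sub>n = \<Sum>j. f\<^sub>j(e\<^sub>n) y\<^sub>j\<close> gives \<open>1 \<le> \<Sum>j. a\<^sub>j w\<^sub>q(n) \<bar>y\<^sub>j(n)\<bar>\<close>, where \<open>w\<^sub>q(n) \<le> 1\<close>.
  Multiplying by \<open>w\<^sub>p(n)\<close> and summing over \<open>n\<close> bounds \<open>\<Sum>n. w\<^sub>p(n)\<close> by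
  \<open>\<Sum>j. a\<^sub>j \<parallel>y\<^sub>j\<parallel>\<^sub>p\<close>, which is finite.
\<close>

lemma nuclear_Lambda1_summable_weights:
  fixes \<alpha> :: "nat \<Rightarrow> real"
  assumes nonneg: "\<And>n. 1 \<le> n \<Longrightarrow> 0 \<le> \<alpha> n"
    and nuc: "nuclear_space (Lambda1 \<alpha> :: (nat \<Rightarrow> 'a::{real_normed_field,banach}) set) (Lambda1_norm \<alpha>)"
    and p: "1 \<le> p"
  shows "summable (\<lambda>n. exp (- (1 / real p) * \<alpha> (Suc n)))"
proof -
  obtain q and f :: "nat \<Rightarrow> (nat \<Rightarrow> 'a) \<Rightarrow> 'a" and a :: "nat \<Rightarrow> real"
    and y :: "nat \<Rightarrow> nat \<Rightarrow> 'a" where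
    "\<forall>j. linear_functional_on (Lambda1 \<alpha>) (f j) \<and> 0 \<le> a j \<and>
      (\<forall>x\<in>Lambda1 \<alpha>. norm (f j x) \<le> a j * Lambda1_norm \<alpha> q x)"
    and "\<forall>j. y j \<in> Lambda1 \<alpha>"
    and sm: "summable (\<lambda>j. a j * Lambda1_norm \<alpha> p (y j))"
    and "\<forall>x\<in>Lambda1 \<alpha>.
      (\<lambda>N. Lambda1_norm \<alpha> p (\<lambda>i. x i - (\<Sum>j<N. f j x * y j i))) \<longlonglongrightarrow> 0"
    using nuc[unfolded nuclear_space_def, rule_format, OF p] by (elim exE conjE) (rule that)
  then have a: "\<And>j. 0 \<le> a j"
    and f: "\<And>j x. x \<in> Lambda1 \<alpha> \<Longrightarrow> norm (f j x) \<le> a j * Lambda1_norm \<alpha> q x"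
    and y: "\<And>j. y j \<in> Lambda1 \<alpha>"
    and lim: "\<And>x. x \<in> Lambda1 \<alpha> \<Longrightarrow>
      (\<lambda>N. Lambda1_norm \<alpha> p (\<lambda>i. x i - (\<Sum>j<N. f j x * y j i))) \<longlonglongrightarrow> 0"
    by auto
  let ?w = "\<lambda>k n. exp (- (1 / real k) * \<alpha> n)"
  have w1: "?w q n \<le> 1" if "1 \<le> n" for n
    using nonneg[OF that] by simp
  have smn: "summable (\<lambda>j. a j * (norm (y j (Suc n)) * ?w p (Suc n)))" for n
    by (rule summable_comparison_test'[OF sm, of 0])
      (use a coordinate_le_Lambda1_norm[OF y p] in \<open>auto intro!: mult_left_mono\<close>)
  have diag: "?w p (Suc n) \<le> (\<Sum>j. a j * (norm (y j (Suc n)) * ?w p (Suc n)))" for n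
  proof -
    let ?e = "canonical_basis (Suc n) :: nat \<Rightarrow> 'a"
    let ?c = "\<lambda>N. \<Sum>j<N. f j ?e * y j (Suc n)"
    have eE: "?e \<in> Lambda1 \<alpha>" by (simp add: canonical_basis_in_Lambda1)
    have fe: "norm (f j ?e) \<le> a j" for j
    proof -
      have "norm (f j ?e) \<le> a j * ?w q (Suc n)"
        using f[OF eE, of j] by (simp add: Lambda1_norm_canonical_basis)
      also have "\<dots> \<le> a j" using a[of j] w1[of "Suc n"] by (simp add: mult_left_le)
      finally show ?thesis .
    qed
    have bound: "?w p (Suc n) \<le> Lambda1_norm \<alpha> p (\<lambda>i. ?e i - (\<Sum>j<N. f j ?e * y j i))
        + (\<Sum>j. a j * (norm (y j (Suc n)) * ?w p (Suc n)))" for N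
    proof -
      have "1 = norm (?e (Suc n))" by (simp add: canonical_basis_def)
      also have "\<dots> \<le> norm (?e (Suc n) - ?c N) + norm (?c N)"
        using norm_triangle_ineq[of "?e (Suc n) - ?c N" "?c N"] by simp
      finally have one: "1 \<le> norm (?e (Suc n) - ?c N) + norm (?c N)" .
      have "?w p (Suc n) \<le> norm (?e (Suc n) - ?c N) * ?w p (Suc n) + norm (?c N) * ?w p (Suc n)"
        using mult_right_mono[OF one, of "?w p (Suc n)"] by (simp add: distrib_right)
      moreover have "norm (?e (Suc n) - ?c N) * ?w p (Suc n)
          \<le> Lambda1_norm \<alpha> p (\<lambda>i. ?e i - (\<Sum>j<N. f j ?e * y j i))"
        by (rule coordinate_le_Lambda1_norm[OF Lambda1_diff[OF eE Lambda1_sum[OF y]] p]) simp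
      moreover have "norm (?c N) * ?w p (Suc n)
          \<le> (\<Sum>j. a j * (norm (y j (Suc n)) * ?w p (Suc n)))"
      proof -
        have "norm (?c N) \<le> (\<Sum>j<N. a j * norm (y j (Suc n)))"
          by (rule sum_norm_le) (simp add: norm_mult mult_right_mono fe)
        then have "norm (?c N) * ?w p (Suc n) \<le> (\<Sum>j<N. a j * norm (y j (Suc n))) * ?w p (Suc n)"
          by (rule mult_right_mono) simp
        also have "\<dots> = (\<Sum>j<N. a j * (norm (y j (Suc n)) * ?w p (Suc n)))"
          by (simp add: sum_distrib_right mult.assoc)
        also have "\<dots> \<le> (\<Sum>j. a j * (norm (y j (Suc n)) * ?w p (Suc n)))"
          by (rule sum_le_suminf[OF smn]) (use a in auto)
        finally show ?thesis .
      qed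
      ultimately show ?thesis by linarith
    qed
    have "(\<lambda>N. Lambda1_norm \<alpha> p (\<lambda>i. ?e i - (\<Sum>j<N. f j ?e * y j i))
        + (\<Sum>j. a j * (norm (y j (Suc n)) * ?w p (Suc n))))
      \<longlonglongrightarrow> 0 + (\<Sum>j. a j * (norm (y j (Suc n)) * ?w p (Suc n)))"
      by (intro tendsto_add lim[OF eE] tendsto_const)
    from LIMSEQ_le_const[OF this] bound show ?thesis by auto
  qed
  show ?thesis
  proof (rule summableI_nonneg_bounded)
    fix N
    have "(\<Sum>n<N. ?w p (Suc n)) \<le> (\<Sum>n<N. \<Sum>j. a j * (norm (y j (Suc n)) * ?w p (Suc n)))"
      by (intro sum_mono diag)
    also have "\<dots> = (\<Sum>j. \<Sum>n<N. a j * (norm (y j (Suc n)) * ?w p (Suc n)))"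
      by (rule suminf_sum[symmetric]) (rule smn)
    also have "\<dots> \<le> (\<Sum>j. a j * Lambda1_norm \<alpha> p (y j))"
    proof (rule suminf_le[OF _ _ sm])
      show "summable (\<lambda>j. \<Sum>n<N. a j * (norm (y j (Suc n)) * ?w p (Suc n)))"
        by (rule summable_sum) (rule smn)
      show "(\<Sum>n<N. a j * (norm (y j (Suc n)) * ?w p (Suc n))) \<le> a j * Lambda1_norm \<alpha> p (y j)" for j
        unfolding sum_distrib_left[symmetric] Lambda1_norm_def
        by (intro mult_left_mono a sum_le_suminf Lambda1_summable y p) auto
    qed
    finally show "(\<Sum>n<N. ?w p (Suc n)) \<le> (\<Sum>j. a j * Lambda1_norm \<alpha> p (y j))" .
  qed simp
qed

text \<open>
  The additive constant takes care of the finitely many \<open>n\<close> at which \<open>\<alpha> n\<close> may vanish, where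
  the quotient in the definition of stability carries no information.
\<close>

lemma stable_sequence_doubling:
  fixes \<alpha> :: "nat \<Rightarrow> real"
  assumes nonneg: "\<And>n. 1 \<le> n \<Longrightarrow> 0 \<le> \<alpha> n"
    and top: "filterlim \<alpha> at_top sequentially"
    and stable: "stable_sequence \<alpha>"
  obtains S A where "1 \<le> S" and "\<forall>n\<ge>1. \<alpha> (2 * n) \<le> S * \<alpha> n + A"
proof -
  from stable obtain S where S: "\<And>n. 1 \<le> n \<Longrightarrow> \<alpha> (2 * n) / \<alpha> n \<le> S"
    by (auto simp: stable_sequence_def bdd_above_def)
  from top obtain N where N: "\<And>n. N \<le> n \<Longrightarrow> 1 \<le> \<alpha> n"
    by (auto simp: filterlim_at_top eventually_sequentially)
  show ?thesis
  proof (rule that[of "max 1 S"], simp, intro allI impI)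
    fix n :: nat assume n: "1 \<le> n"
    have A: "0 \<le> (\<Sum>m\<in>{1..N}. \<alpha> (2 * m))" by (intro sum_nonneg nonneg) auto
    show "\<alpha> (2 * n) \<le> max 1 S * \<alpha> n + (\<Sum>m\<in>{1..N}. \<alpha> (2 * m))"
    proof (cases "N \<le> n")
      case True
      then have pos: "0 < \<alpha> n" using N[of n] by simp
      then have "\<alpha> (2 * n) \<le> S * \<alpha> n" using S[OF n] by (simp add: field_simps)
      also have "\<dots> \<le> max 1 S * \<alpha> n" using pos by (intro mult_right_mono) auto
      finally show ?thesis using A by simp
    next
      case False
      then have "\<alpha> (2 * n) \<le> (\<Sum>m\<in>{1..N}. \<alpha> (2 * m))"
        using n by (intro member_le_sum nonneg) auto
      moreover have "0 \<le> max 1 S * \<alpha> n" using nonneg[OF n] by simp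
      ultimately show ?thesis by simp
    qed
  qed
qed



section \<open>Adjoints of convolution operators\<close>

definition conv_adjoint ::
  "(nat \<Rightarrow> 'a::{real_normed_field,banach}) \<Rightarrow> (nat \<Rightarrow> 'a) \<Rightarrow> (nat \<Rightarrow> 'a)"
  where "conv_adjoint b x = (\<lambda>i. if i = 0 then 0 else \<Sum>m. b m * x (i + m))"

lemma conv_adjoint_zero [simp]: "conv_adjoint b x 0 = 0"
  by (simp add: conv_adjoint_def)

lemma conv_adjoint_finite_support:
  assumes "1 \<le> i" and "\<And>n. n > N \<Longrightarrow> x n = 0"
  shows "conv_adjoint b x i = (\<Sum>m\<le>N. b m * x (i + m))"
proof -
  have "(\<Sum>m. b m * x (i + m)) = (\<Sum>m\<le>N. b m * x (i + m))"
    by (rule suminf_finite) (auto simp: assms(2))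
  then show ?thesis using assms(1) by (simp add: conv_adjoint_def)
qed

lemma conv_adjoint_canonical_basis_first:
  assumes "1 \<le> n"
  shows "conv_adjoint b (canonical_basis n) 1 = b (n - 1)"
proof -
  have "conv_adjoint b (canonical_basis n) 1 = (\<Sum>m\<le>n. b m * canonical_basis n (1 + m))"
    by (rule conv_adjoint_finite_support) (auto simp: canonical_basis_def)
  also have "\<dots> = (\<Sum>m\<in>{n - 1}. b m * canonical_basis n (1 + m))"
    using assms by (intro sum.mono_neutral_right) (auto simp: canonical_basis_def)
  finally show ?thesis using assms by (simp add: canonical_basis_def)
qed

lemma dual_conv_basis_eq:
  "dual_conv_basis b n i = (if 1 \<le> i \<and> i \<le> n then b (n - i) else 0)"
proof -
  have "dual_conv_basis b n i = (\<Sum>j=1..n. if i = j then b (n - j) else 0)"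
    unfolding dual_conv_basis_def canonical_basis_def by (intro sum.cong) auto
  then show ?thesis by (simp add: sum.delta)
qed

text \<open>
  The series that defines \<open>dual_conv\<close> has as partial sums the images of the truncations of \<open>x\<close>, so
  its convergence will be a matter of continuity of \<open>conv_adjoint\<close>.
\<close>

lemma partial_sum_dual_conv_basis:
  "(\<Sum>n=1..N. x n * dual_conv_basis b n i)
    = conv_adjoint b (\<lambda>n. if 1 \<le> n \<and> n \<le> N then x n else 0) i"
proof (cases "1 \<le> i")
  case False
  then have "i = 0" by simp
  then show ?thesis by (simp add: dual_conv_basis_eq)
next
  case True
  have "(\<Sum>n=1..N. x n * dual_conv_basis b n i) = (\<Sum>n\<in>{i..N}. b (n - i) * x n)"
    using True by (intro sum.mono_neutral_cong_right) (auto simp: dual_conv_basis_eq)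
  also have "\<dots> = (\<Sum>m | i + m \<le> N. b m * x (i + m))"
    by (rule sum.reindex_bij_witness[where i = "\<lambda>m. i + m" and j = "\<lambda>n. n - i"]) auto
  also have "\<dots> = (\<Sum>m\<le>N. b m * (if 1 \<le> i + m \<and> i + m \<le> N then x (i + m) else 0))"
    using True by (intro sum.mono_neutral_cong_left) auto
  also have "\<dots> = conv_adjoint b (\<lambda>n. if 1 \<le> n \<and> n \<le> N then x n else 0) i"
    by (rule conv_adjoint_finite_support[symmetric]) (use True in auto)
  finally show ?thesis .
qed

lemma Lambda1_dual_iff:
  "b \<in> Lambda1_dual \<alpha> \<longleftrightarrow>
    (\<exists>m\<ge>(1::nat). \<exists>C>0. \<forall>n. norm (b n) \<le> C * exp (- (1 / real m) * \<alpha> (Suc n)))"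
proof -
  have "(\<forall>n\<ge>1. norm (b (n - 1)) \<le> C * exp (- (1 / real m) * \<alpha> n)) \<longleftrightarrow>
    (\<forall>n. norm (b n) \<le> C * exp (- (1 / real m) * \<alpha> (Suc n)))" for m C
    by (metis One_nat_def Suc_le_mono diff_Suc_1 le0 not0_implies_Suc not_one_le_zero)
  then show ?thesis by (simp only: Lambda1_dual_def mem_Collect_eq)
qed

text \<open>
  Stability and nuclearity enter the estimates only through the doubling inequality and the
  summability of the weights. Nuclearity of \<open>Lambda1 \<alpha>\<close> refers to one scalar field, whereas
  these conditions refer to none, so the results below can also be used for real sequences of
  norms when the scalars are different.
\<close>

locale stable_nuclear_weight =
  fixes \<alpha> :: "nat \<Rightarrow> real" and S A :: real
  assumes nonneg: "\<And>n. 1 \<le> n \<Longrightarrow> 0 \<le> \<alpha> n"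
    and mono: "\<And>m n. 1 \<le> m \<Longrightarrow> m \<le> n \<Longrightarrow> \<alpha> m \<le> \<alpha> n"
    and S: "1 \<le> S"
    and doubling: "\<And>n. 1 \<le> n \<Longrightarrow> \<alpha> (2 * n) \<le> S * \<alpha> n + A"
    and summable_weight: "\<And>r. 1 \<le> r \<Longrightarrow> summable (\<lambda>n. exp (- (1 / real r) * \<alpha> (Suc n)))"
begin

abbreviation weight :: "nat \<Rightarrow> nat \<Rightarrow> real"
  where "weight r n \<equiv> exp (- (1 / real r) * \<alpha> n)"

lemma weight_antimono:
  assumes "1 \<le> r" and "r \<le> s" and "1 \<le> n"
  shows "weight r n \<le> weight s n"
  using assms nonneg[OF assms(3)] by (simp add: frac_le)

text \<open>
  With \<open>s = max p r\<close> all weights may be taken of index \<open>s\<close>. In a product of weights at two indices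
  with sum \<open>n + 2\<close>, the larger index \<open>m\<close> satisfies \<open>\<alpha> (n + 1) \<le> \<alpha> (2 m) \<le> S \<alpha> m + A\<close>, so its
  weight is at most a constant times \<open>weight q (n + 1)\<close> as soon as \<open>q \<ge> S s\<close>. The other weight
  runs through a summable sequence.
\<close>

lemma triangle_weight_bound:
  assumes p: "1 \<le> p" and r: "1 \<le> r"
  obtains q K where "1 \<le> q" and "0 < K"
    and "\<And>n. (\<Sum>i\<le>n. weight p (Suc i) * weight r (Suc (n - i))) \<le> K * weight q (Suc n)"
proof -
  define s where "s = max p r"
  define q where "q = nat \<lceil>S * real s\<rceil>"
  define M where "M = (\<Sum>n. weight s (Suc n))"
  define E where "E = exp (A / (S * real s))"
  have s: "1 \<le> s" "p \<le> s" "r \<le> s" using p by (auto simp: s_def)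
  have Ss: "0 < S * real s" "S * real s \<le> real q"
    using S s(1) by (simp_all add: q_def)
  have q: "1 \<le> q" using Ss by (cases q) auto
  have M: "0 \<le> M" unfolding M_def by (intro suminf_nonneg summable_weight s) simp
  \<comment> \<open>The larger index carries the decay; the constant \<open>E\<close> absorbs \<open>A\<close>.\<close>
  have half: "weight s m \<le> E * weight q (Suc n)" if m: "1 \<le> m" "Suc n \<le> 2 * m" for m n
  proof -
    have "\<alpha> (Suc n) \<le> S * \<alpha> m + A"
      using mono[of "Suc n" "2 * m"] doubling[of m] m by simp
    then have "(\<alpha> (Suc n) - A) / (S * real s) \<le> (S * \<alpha> m) / (S * real s)"
      using Ss by (intro divide_right_mono) auto
    also have "\<dots> = \<alpha> m / real s" using S by simp
    finally have "- (\<alpha> m / real s) \<le> A / (S * real s) - \<alpha> (Suc n) / (S * real s)"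
      by (simp add: diff_divide_distrib)
    also have "\<dots> \<le> A / (S * real s) - \<alpha> (Suc n) / real q"
      using Ss nonneg[of "Suc n"] by (simp add: frac_le)
    finally show ?thesis by (simp add: E_def flip: exp_add)
  qed
  have summand: "weight p (Suc i) * weight r (Suc (n - i))
      \<le> E * weight q (Suc n) * (weight s (Suc i) + weight s (Suc (n - i)))" if i: "i \<le> n" for i n
  proof -
    have "weight p (Suc i) * weight r (Suc (n - i)) \<le> weight s (Suc i) * weight s (Suc (n - i))"
      using p r s by (intro mult_mono weight_antimono) auto
    also have "\<dots> \<le> E * weight q (Suc n) * (weight s (Suc i) + weight s (Suc (n - i)))"
    proof (cases "Suc n \<le> 2 * Suc i")
      case True
      then have "weight s (Suc i) * weight s (Suc (n - i))
          \<le> (E * weight q (Suc n)) * weight s (Suc (n - i))"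
        by (intro mult_right_mono half) auto
      also have "\<dots> \<le> (E * weight q (Suc n)) * (weight s (Suc i) + weight s (Suc (n - i)))"
        by (intro mult_left_mono) (auto simp: E_def)
      finally show ?thesis .
    next
      case False
      then have "weight s (Suc i) * weight s (Suc (n - i))
          \<le> weight s (Suc i) * (E * weight q (Suc n))"
        by (intro mult_left_mono half) auto
      also have "\<dots> = (E * weight q (Suc n)) * weight s (Suc i)" by (rule mult.commute)
      also have "\<dots> \<le> (E * weight q (Suc n)) * (weight s (Suc i) + weight s (Suc (n - i)))"
        by (intro mult_left_mono) (auto simp: E_def)
      finally show ?thesis .
    qed
    finally show ?thesis .
  qed
  show ?thesis
  proof (rule that[of q "E * (2 * M) + 1"])
    show "0 < E * (2 * M) + 1" using M by (simp add: E_def add_nonneg_pos)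
    fix n
    \<comment> \<open>Each of the two weights is summed over at most all indices, which accounts for \<open>2 * M\<close>.\<close>
    have M1: "(\<Sum>i\<le>n. weight s (Suc i)) \<le> M"
      unfolding M_def by (intro sum_le_suminf summable_weight s) auto
    moreover have "(\<Sum>i\<le>n. weight s (Suc (n - i))) = (\<Sum>i\<le>n. weight s (Suc i))"
      by (rule sum.reindex_bij_witness[where i = "\<lambda>i. n - i" and j = "\<lambda>i. n - i"]) auto
    ultimately have M2: "(\<Sum>i\<le>n. weight s (Suc i) + weight s (Suc (n - i))) \<le> 2 * M"
      by (simp only: sum.distrib)
    have "(\<Sum>i\<le>n. weight p (Suc i) * weight r (Suc (n - i)))
        \<le> (\<Sum>i\<le>n. E * weight q (Suc n) * (weight s (Suc i) + weight s (Suc (n - i))))"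
      by (intro sum_mono summand) auto
    also have "\<dots> = E * weight q (Suc n) * (\<Sum>i\<le>n. weight s (Suc i) + weight s (Suc (n - i)))"
      by (rule sum_distrib_left[symmetric])
    also have "\<dots> \<le> E * weight q (Suc n) * (2 * M)"
      by (intro mult_left_mono M2) (simp add: E_def)
    also have "\<dots> \<le> (E * (2 * M) + 1) * weight q (Suc n)"
      by (simp add: algebra_simps)
    finally show "(\<Sum>i\<le>n. weight p (Suc i) * weight r (Suc (n - i)))
        \<le> (E * (2 * M) + 1) * weight q (Suc n)" .
  qed (rule q)
qed

lemma seq_conv_in_dual:
  fixes b c :: "nat \<Rightarrow> 'a::{real_normed_field,banach}"
  assumes b: "b \<in> Lambda1_dual \<alpha>" and c: "c \<in> Lambda1_dual \<alpha>"
  shows "seq_conv b c \<in> Lambda1_dual \<alpha>"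
proof -
  from b obtain p B where p: "1 \<le> p" and B: "0 < B" "\<And>n. norm (b n) \<le> B * weight p (Suc n)"
    unfolding Lambda1_dual_iff by blast
  from c obtain r C where r: "1 \<le> r" and C: "0 < C" "\<And>n. norm (c n) \<le> C * weight r (Suc n)"
    unfolding Lambda1_dual_iff by blast
  obtain q K where q: "1 \<le> q" and K: "0 < K"
      "\<And>n. (\<Sum>i\<le>n. weight p (Suc i) * weight r (Suc (n - i))) \<le> K * weight q (Suc n)"
    by (rule triangle_weight_bound[OF p r]) (rule that)
  have "norm (seq_conv b c n) \<le> (B * C * K) * weight q (Suc n)" for n
  proof -
    have "norm (seq_conv b c n)
        \<le> (\<Sum>i\<le>n. (B * weight p (Suc i)) * (C * weight r (Suc (n - i))))"
      unfolding seq_conv_def atLeast0AtMost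
    proof (rule sum_norm_le)
      show "norm (b i * c (n - i)) \<le> (B * weight p (Suc i)) * (C * weight r (Suc (n - i)))" for i
        unfolding norm_mult using B(1) by (intro mult_mono B(2) C(2)) auto
    qed
    also have "\<dots> = (B * C) * (\<Sum>i\<le>n. weight p (Suc i) * weight r (Suc (n - i)))"
      by (simp add: sum_distrib_left mult_ac)
    also have "\<dots> \<le> (B * C) * (K * weight q (Suc n))"
      using B C by (intro mult_left_mono K) auto
    finally show ?thesis by (simp add: mult_ac)
  qed
  moreover have "0 < B * C * K" using B C K by simp
  ultimately show ?thesis unfolding Lambda1_dual_iff using q by blast
qed

lemma conv_power_in_dual:
  assumes "b \<in> Lambda1_dual \<alpha>"
  shows "conv_power b k \<in> Lambda1_dual \<alpha>"
proof (induction k)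
  case 0
  have "norm (conv_power b 0 n) \<le> exp (\<alpha> 1) * weight 1 (Suc n)" for n
    by (simp flip: exp_add)
  then show ?case
    unfolding Lambda1_dual_iff by (intro exI[of _ 1] exI[of _ "exp (\<alpha> 1)"] conjI) auto
next
  case (Suc k)
  then show ?case using assms by (simp add: seq_conv_in_dual)
qed

text \<open>
  The quantities \<open>q\<close> and \<open>K\<close> depend on \<open>p\<close> and on the decay rate \<open>1 / r\<close>, but not on \<open>b\<close>. The
  double series with terms \<open>\<bar>b\<^sub>m x\<^sub>i\<^sub>+\<^sub>m\<bar>\<close>, weighted in \<open>i\<close>, bounds the norm of the image when it is
  summed by rows; its diagonals collect the terms with a common \<open>x\<^sub>n\<close> and are controlled by
  hypothesis.
\<close>

lemma conv_adjoint_estimate: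
  fixes b x :: "nat \<Rightarrow> 'a::{real_normed_field,banach}"
  assumes q: "1 \<le> q"
    and K: "\<And>n. (\<Sum>i\<le>n. weight p (Suc i) * weight r (Suc (n - i))) \<le> K * weight q (Suc n)"
    and B: "0 \<le> B" "\<And>n. norm (b n) \<le> B * weight r (Suc n)"
    and x: "x \<in> Lambda1 \<alpha>"
  shows conv_adjoint_row: "summable (\<lambda>m. norm (b m * x (Suc i + m)))"
    and conv_adjoint_summable: "summable (\<lambda>i. norm (conv_adjoint b x (Suc i)) * weight p (Suc i))"
    and conv_adjoint_norm_le:
      "Lambda1_norm \<alpha> p (conv_adjoint b x) \<le> B * K * Lambda1_norm \<alpha> q x"
proof -
  define f where "f i m = weight p (Suc i) * norm (b m * x (Suc i + m))" for i m
  have f: "\<bar>f i m\<bar> = f i m" for i m by (simp add: f_def)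
  have sm: "summable (\<lambda>n. B * K * (norm (x (Suc n)) * weight q (Suc n)))"
    by (intro summable_mult Lambda1_summable x q)
  have diag: "(\<Sum>i\<le>n. f i (n - i)) \<le> B * K * (norm (x (Suc n)) * weight q (Suc n))" for n
  proof -
    have "(\<Sum>i\<le>n. f i (n - i))
        = norm (x (Suc n)) * (\<Sum>i\<le>n. weight p (Suc i) * norm (b (n - i)))"
      by (simp add: f_def sum_distrib_left norm_mult mult_ac)
    also have "\<dots> \<le> norm (x (Suc n)) * (\<Sum>i\<le>n. weight p (Suc i) * (B * weight r (Suc (n - i))))"
      by (intro mult_left_mono sum_mono B) auto
    also have "\<dots> = norm (x (Suc n)) * B * (\<Sum>i\<le>n. weight p (Suc i) * weight r (Suc (n - i)))"
      by (simp add: sum_distrib_left mult_ac)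
    also have "\<dots> \<le> norm (x (Suc n)) * B * (K * weight q (Suc n))"
      using B by (intro mult_left_mono K) auto
    finally show ?thesis by (simp add: mult_ac)
  qed
  have f0: "0 \<le> f i m" for i m by (simp add: f_def)
  have S: "summable (\<lambda>n. \<Sum>i\<le>n. norm (f i (n - i)))"
    by (rule summable_comparison_test'[OF sm, of 0]) (use diag f0 in \<open>simp add: f sum_nonneg\<close>)
  have row: "summable (f i)" for i
    using triangle_sums_row[OF S, of i] by (simp add: f)
  show rowb: "summable (\<lambda>m. norm (b m * x (Suc i + m)))" for i
    using row[of i] unfolding f_def by (rule summable_mult_D) simp
  have le: "norm (conv_adjoint b x (Suc i)) * weight p (Suc i) \<le> (\<Sum>m. f i m)" for i
  proof -
    have "norm (conv_adjoint b x (Suc i)) \<le> (\<Sum>m. norm (b m * x (Suc i + m)))"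
      using summable_norm[OF rowb[of i]] by (simp add: conv_adjoint_def)
    then have "norm (conv_adjoint b x (Suc i)) * weight p (Suc i)
        \<le> (\<Sum>m. norm (b m * x (Suc i + m))) * weight p (Suc i)"
      by (rule mult_right_mono) simp
    also have "\<dots> = (\<Sum>m. f i m)"
      unfolding f_def by (subst mult.commute) (rule suminf_mult[OF rowb, symmetric])
    finally show ?thesis .
  qed
  have abs: "summable (\<lambda>i. \<Sum>m. f i m)"
    using triangle_sums_abs[OF S] by (simp add: f)
  show sml: "summable (\<lambda>i. norm (conv_adjoint b x (Suc i)) * weight p (Suc i))"
    by (rule summable_comparison_test'[OF abs, of 0]) (use le in simp)
  have "Lambda1_norm \<alpha> p (conv_adjoint b x) \<le> (\<Sum>i. \<Sum>m. f i m)"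
    unfolding Lambda1_norm_def by (rule suminf_le[OF le sml abs])
  also have "\<dots> = (\<Sum>n. \<Sum>i\<le>n. f i (n - i))"
    by (rule triangle_sums_eq[OF S])
  also have "\<dots> \<le> (\<Sum>n. B * K * (norm (x (Suc n)) * weight q (Suc n)))"
    using S by (intro suminf_le[OF diag _ sm]) (simp add: f)
  also have "\<dots> = B * K * Lambda1_norm \<alpha> q x"
    unfolding Lambda1_norm_def by (intro suminf_mult Lambda1_summable x q)
  finally show "Lambda1_norm \<alpha> p (conv_adjoint b x) \<le> B * K * Lambda1_norm \<alpha> q x" .
qed

lemma conv_adjoint_bound:
  fixes b :: "nat \<Rightarrow> 'a::{real_normed_field,banach}"
  assumes b: "b \<in> Lambda1_dual \<alpha>" and p: "1 \<le> p"
  obtains q C where "1 \<le> q" and "0 < C"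
    and "\<forall>x\<in>Lambda1 \<alpha>. Lambda1_norm \<alpha> p (conv_adjoint b x) \<le> C * Lambda1_norm \<alpha> q x"
proof -
  from b obtain r B where r: "1 \<le> r" and B: "0 < B" "\<And>n. norm (b n) \<le> B * weight r (Suc n)"
    unfolding Lambda1_dual_iff by blast
  obtain q K where q: "1 \<le> q" and K: "0 < K"
      "\<And>n. (\<Sum>i\<le>n. weight p (Suc i) * weight r (Suc (n - i))) \<le> K * weight q (Suc n)"
    by (rule triangle_weight_bound[OF p r]) (rule that)
  show ?thesis
  proof (rule that[OF q])
    show "0 < B * K" using B K by simp
    show "\<forall>x\<in>Lambda1 \<alpha>. Lambda1_norm \<alpha> p (conv_adjoint b x) \<le> B * K * Lambda1_norm \<alpha> q x"
      by (intro ballI conv_adjoint_norm_le[OF q K(2) less_imp_le[OF B(1)] B(2)])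
  qed
qed

lemma conv_adjoint_terms_summable:
  assumes b: "b \<in> Lambda1_dual \<alpha>" and x: "x \<in> Lambda1 \<alpha>" and i: "1 \<le> i"
  shows "summable (\<lambda>m. norm (b m * x (i + m)))"
proof -
  from b obtain r B where r: "1 \<le> r" and B: "0 < B" "\<And>n. norm (b n) \<le> B * weight r (Suc n)"
    unfolding Lambda1_dual_iff by blast
  obtain q K where q: "1 \<le> q"
      and K: "\<And>n. (\<Sum>i\<le>n. weight 1 (Suc i) * weight r (Suc (n - i))) \<le> K * weight q (Suc n)"
    by (rule triangle_weight_bound[OF order.refl r]) (rule that)
  from i obtain i' where "i = Suc i'" by (cases i) auto
  then show ?thesis
    using conv_adjoint_row[OF q K less_imp_le[OF B(1)] B(2) x, of i'] by simp
qed

lemma conv_adjoint_in_Lambda1: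
  assumes b: "b \<in> Lambda1_dual \<alpha>" and x: "x \<in> Lambda1 \<alpha>"
  shows "conv_adjoint b x \<in> Lambda1 \<alpha>"
proof -
  from b obtain r B where r: "1 \<le> r" and B: "0 < B" "\<And>n. norm (b n) \<le> B * weight r (Suc n)"
    unfolding Lambda1_dual_iff by blast
  have "summable (\<lambda>i. norm (conv_adjoint b x (Suc i)) * weight p (Suc i))" if p: "1 \<le> p" for p
  proof -
    obtain q K where q: "1 \<le> q"
        and K: "\<And>n. (\<Sum>i\<le>n. weight p (Suc i) * weight r (Suc (n - i))) \<le> K * weight q (Suc n)"
      by (rule triangle_weight_bound[OF p r]) (rule that)
    show ?thesis by (rule conv_adjoint_summable[OF q K less_imp_le[OF B(1)] B(2) x])
  qed
  then show ?thesis by (simp add: Lambda1_def)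
qed

lemma conv_adjoint_lincomb:
  assumes b: "b \<in> Lambda1_dual \<alpha>" and x: "x \<in> Lambda1 \<alpha>" and y: "y \<in> Lambda1 \<alpha>"
  shows "conv_adjoint b (\<lambda>i. s * x i + t * y i)
    = (\<lambda>i. s * conv_adjoint b x i + t * conv_adjoint b y i)"
proof
  fix i
  show "conv_adjoint b (\<lambda>i. s * x i + t * y i) i
    = s * conv_adjoint b x i + t * conv_adjoint b y i"
  proof (cases "i = 0")
    case False
    then have sx: "summable (\<lambda>m. b m * x (i + m))" and sy: "summable (\<lambda>m. b m * y (i + m))"
      by (auto intro!: summable_norm_cancel[OF conv_adjoint_terms_summable[OF b]] x y)
    have "(\<Sum>m. b m * (s * x (i + m) + t * y (i + m)))
        = (\<Sum>m. s * (b m * x (i + m)) + t * (b m * y (i + m)))"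
      by (simp add: algebra_simps)
    also have "\<dots> = s * (\<Sum>m. b m * x (i + m)) + t * (\<Sum>m. b m * y (i + m))"
      by (simp add: suminf_add[symmetric] suminf_mult summable_mult sx sy)
    finally show ?thesis using False by (simp add: conv_adjoint_def)
  qed simp
qed

lemma conv_adjoint_diff:
  assumes "b \<in> Lambda1_dual \<alpha>" and "x \<in> Lambda1 \<alpha>" and "y \<in> Lambda1 \<alpha>"
  shows "conv_adjoint b (\<lambda>i. x i - y i) = (\<lambda>i. conv_adjoint b x i - conv_adjoint b y i)"
  using conv_adjoint_lincomb[OF assms, of 1 "-1"] by simp

text \<open>
  Both sides are sums of \<open>b\<^sub>m c\<^sub>l x\<^sub>i\<^sub>+\<^sub>m\<^sub>+\<^sub>l\<close>, by rows and by diagonals \<open>m + l = n\<close>. Absolute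
  convergence along the diagonals is the convergence of the series for the sequences of norms: the
  convolution of \<open>\<bar>b\<bar>\<close> and \<open>\<bar>c\<bar>\<close> is again in the dual, over the real scalars.
\<close>

lemma conv_adjoint_conv_adjoint:
  fixes b c x :: "nat \<Rightarrow> 'a::{real_normed_field,banach}"
  assumes b: "b \<in> Lambda1_dual \<alpha>" and c: "c \<in> Lambda1_dual \<alpha>" and x: "x \<in> Lambda1 \<alpha>"
  shows "conv_adjoint b (conv_adjoint c x) = conv_adjoint (seq_conv b c) x"
proof
  fix i
  show "conv_adjoint b (conv_adjoint c x) i = conv_adjoint (seq_conv b c) x i"
  proof (cases "i = 0")
    case False
    then have i: "1 \<le> i" by simp
    define f where "f m l = b m * (c l * x (i + m + l))" for m l
    let ?nb = "\<lambda>n. norm (b n)" and ?nc = "\<lambda>n. norm (c n)" and ?nx = "\<lambda>n. norm (x n)"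
    have "seq_conv ?nb ?nc \<in> Lambda1_dual \<alpha>"
      using b c by (intro seq_conv_in_dual) (simp_all add: Lambda1_dual_def)
    moreover have "?nx \<in> Lambda1 \<alpha>" using x by (simp add: Lambda1_def)
    ultimately have "summable (\<lambda>n. norm (seq_conv ?nb ?nc n * ?nx (i + n)))"
      using i by (rule conv_adjoint_terms_summable)
    then have "summable (\<lambda>n. seq_conv ?nb ?nc n * ?nx (i + n))"
      by (rule summable_norm_cancel)
    moreover have "(\<Sum>m\<le>n. norm (f m (n - m))) = seq_conv ?nb ?nc n * ?nx (i + n)" for n
      by (simp add: f_def seq_conv_def atLeast0AtMost sum_distrib_right norm_mult mult.assoc)
    ultimately have S: "summable (\<lambda>n. \<Sum>m\<le>n. norm (f m (n - m)))" by simp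
    have "conv_adjoint b (conv_adjoint c x) i = (\<Sum>m. b m * (\<Sum>l. c l * x (i + m + l)))"
      using i by (simp add: conv_adjoint_def)
    also have "\<dots> = (\<Sum>m. \<Sum>l. f m l)"
      unfolding f_def
      by (intro suminf_cong suminf_mult[symmetric]
          summable_norm_cancel[OF conv_adjoint_terms_summable[OF c x]]) (use i in auto)
    also have "\<dots> = (\<Sum>n. \<Sum>m\<le>n. f m (n - m))"
      by (rule triangle_sums_eq[OF S])
    also have "\<dots> = (\<Sum>n. seq_conv b c n * x (i + n))"
      by (simp add: f_def seq_conv_def atLeast0AtMost sum_distrib_right mult.assoc)
    finally show ?thesis using i by (simp add: conv_adjoint_def)
  qed simp
qed

lemma continuous_linear_operator_conv_adjoint:
  fixes b :: "nat \<Rightarrow> 'a::{real_normed_field,banach}"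
  assumes b: "b \<in> Lambda1_dual \<alpha>"
  shows "continuous_linear_operator (Lambda1 \<alpha>) (Lambda1_norm \<alpha>) (conv_adjoint b)"
  unfolding continuous_linear_operator_def
proof (intro conjI ballI allI impI)
  fix x :: "nat \<Rightarrow> 'a" and p :: nat and \<epsilon> :: real
  assume x: "x \<in> Lambda1 \<alpha>" and p: "1 \<le> p" and \<epsilon>: "0 < \<epsilon>"
  obtain q C where q: "1 \<le> q" and C: "0 < C"
    and le: "\<forall>x\<in>Lambda1 \<alpha>. Lambda1_norm \<alpha> p (conv_adjoint b x) \<le> C * Lambda1_norm \<alpha> q x"
    by (rule conv_adjoint_bound[OF b p]) (rule that)
  show "\<exists>q\<ge>1. \<exists>\<delta>>0. \<forall>y\<in>Lambda1 \<alpha>. Lambda1_norm \<alpha> q (\<lambda>i. y i - x i) < \<delta> \<longrightarrow>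
      Lambda1_norm \<alpha> p (\<lambda>i. conv_adjoint b y i - conv_adjoint b x i) < \<epsilon>"
  proof (intro exI[of _ q] exI[of _ "\<epsilon> / C"] conjI ballI impI)
    fix y assume y: "y \<in> Lambda1 \<alpha>" and d: "Lambda1_norm \<alpha> q (\<lambda>i. y i - x i) < \<epsilon> / C"
    have "Lambda1_norm \<alpha> p (\<lambda>i. conv_adjoint b y i - conv_adjoint b x i)
        \<le> C * Lambda1_norm \<alpha> q (\<lambda>i. y i - x i)"
      using bspec[OF le Lambda1_diff[OF y x]] by (simp add: conv_adjoint_diff[OF b y x])
    also have "\<dots> < \<epsilon>" using d C by (simp add: field_simps)
    finally show "Lambda1_norm \<alpha> p (\<lambda>i. conv_adjoint b y i - conv_adjoint b x i) < \<epsilon>" .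
  qed (use q \<epsilon> C in auto)
qed (use b in \<open>auto intro: conv_adjoint_in_Lambda1 conv_adjoint_lincomb\<close>)

lemma dual_conv_eq_conv_adjoint:
  fixes b x :: "nat \<Rightarrow> 'a::{real_normed_field,banach}"
  assumes b: "b \<in> Lambda1_dual \<alpha>" and x: "x \<in> Lambda1 \<alpha>"
  shows "dual_conv \<alpha> b x = conv_adjoint b x"
proof -
  let ?x = "\<lambda>N n. if 1 \<le> n \<and> n \<le> N then x n else 0"
  let ?X = "\<lambda>N i. \<Sum>n=1..N. x n * dual_conv_basis b n i"
  have X: "?X N = conv_adjoint b (?x N)" for N
    by (rule ext) (rule partial_sum_dual_conv_basis)
  have XE: "?X N \<in> Lambda1 \<alpha>" for N
    unfolding X by (intro conv_adjoint_in_Lambda1 b Lambda1_truncation)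
  have lim: "converges_in (Lambda1 \<alpha>) (Lambda1_norm \<alpha>) ?X (conv_adjoint b x)"
    unfolding converges_in_def
  proof (intro conjI allI impI)
    show "conv_adjoint b x \<in> Lambda1 \<alpha>" by (rule conv_adjoint_in_Lambda1[OF b x])
    fix p :: nat assume p: "1 \<le> p"
    obtain q C where q: "1 \<le> q"
      and le: "\<forall>x\<in>Lambda1 \<alpha>. Lambda1_norm \<alpha> p (conv_adjoint b x) \<le> C * Lambda1_norm \<alpha> q x"
      by (rule conv_adjoint_bound[OF b p]) (rule that)
    show "(\<lambda>N. Lambda1_norm \<alpha> p (\<lambda>i. ?X N i - conv_adjoint b x i)) \<longlonglongrightarrow> 0"
    proof (rule Lim_null_comparison)
      show "\<forall>\<^sub>F N in sequentially. norm (Lambda1_norm \<alpha> p (\<lambda>i. ?X N i - conv_adjoint b x i))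
          \<le> C * Lambda1_norm \<alpha> q (\<lambda>n. ?x N n - x n)"
      proof (intro always_eventually allI)
        fix N
        have "0 \<le> Lambda1_norm \<alpha> p (\<lambda>i. ?X N i - conv_adjoint b x i)"
          by (intro Lambda1_norm_nonneg Lambda1_diff XE conv_adjoint_in_Lambda1 b x p)
        moreover have "Lambda1_norm \<alpha> p (conv_adjoint b (\<lambda>n. ?x N n - x n))
            \<le> C * Lambda1_norm \<alpha> q (\<lambda>n. ?x N n - x n)"
          by (intro bspec[OF le] Lambda1_diff Lambda1_truncation x)
        ultimately show "norm (Lambda1_norm \<alpha> p (\<lambda>i. ?X N i - conv_adjoint b x i))
          \<le> C * Lambda1_norm \<alpha> q (\<lambda>n. ?x N n - x n)"
          unfolding X partial_sum_dual_conv_basis conv_adjoint_diff[OF b Lambda1_truncation x]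
          by (simp only: real_norm_def abs_of_nonneg)
      qed
      show "(\<lambda>N. C * Lambda1_norm \<alpha> q (\<lambda>n. ?x N n - x n)) \<longlonglongrightarrow> 0"
        by (intro tendsto_mult_right_zero Lambda1_norm_truncation_tendsto x q)
    qed
  qed
  show ?thesis
    unfolding dual_conv_def
    by (rule the_equality, rule lim, rule converges_in_Lambda1_unique[OF XE _ lim])
qed

lemma dual_conv_funpow:
  assumes b: "b \<in> Lambda1_dual \<alpha>" and x: "x \<in> Lambda1 \<alpha>"
  shows "(dual_conv \<alpha> b ^^ k) x = conv_adjoint (conv_power b k) x"
proof (induction k)
  case 0
  have "conv_adjoint (conv_power b 0) x i = x i" for i
  proof (cases "i = 0")
    case False
    have "(\<Sum>m. conv_power b 0 m * x (i + m)) = (\<Sum>m\<in>{0}. conv_power b 0 m * x (i + m))"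
      by (rule suminf_finite) auto
    with False show ?thesis by (simp add: conv_adjoint_def)
  qed (simp add: Lambda1_zero[OF x])
  then show ?case by auto
next
  case (Suc k)
  have "(dual_conv \<alpha> b ^^ Suc k) x = dual_conv \<alpha> b (conv_adjoint (conv_power b k) x)"
    by (simp add: Suc)
  also have "\<dots> = conv_adjoint (conv_power b (Suc k)) x"
    by (simp add: dual_conv_eq_conv_adjoint conv_adjoint_conv_adjoint
        conv_adjoint_in_Lambda1 conv_power_in_dual b x)
  finally show ?case .
qed

lemma continuous_linear_operator_dual_conv:
  assumes b: "b \<in> Lambda1_dual \<alpha>"
  shows "continuous_linear_operator (Lambda1 \<alpha>) (Lambda1_norm \<alpha>) (dual_conv \<alpha> b)"
proof -
  have "(\<lambda>i. s * x i + t * y i) \<in> Lambda1 \<alpha>" if "x \<in> Lambda1 \<alpha>" "y \<in> Lambda1 \<alpha>"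
    for s t and x y :: "nat \<Rightarrow> 'a" by (rule Lambda1_lincomb[OF that])
  then show ?thesis
    using continuous_linear_operator_conv_adjoint[OF b]
    by (simp add: continuous_linear_operator_def dual_conv_eq_conv_adjoint[OF b])
qed


section \<open>Iterates and convolution powers\<close>

text \<open>
  The constant \<open>K\<close> is independent of \<open>k\<close>; taking \<open>c k = D ^ k\<close> or \<open>c\<close> constant gives the two
  parts of the theorem.
\<close>

lemma conv_power_decay_imp_iterate_bound:
  fixes b :: "nat \<Rightarrow> 'a::{real_normed_field,banach}" and c :: "nat \<Rightarrow> real"
  assumes b: "b \<in> Lambda1_dual \<alpha>" and p: "1 \<le> p" and r: "1 \<le> r"
    and c: "\<And>k. 0 \<le> c k"
    and decay: "\<forall>k\<ge>1. \<forall>n\<ge>1. norm (conv_power b k (n - 1)) \<le> c k * weight r n"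
  obtains q K where "1 \<le> q" and "0 < K"
    and "\<forall>k\<ge>1. \<forall>x\<in>Lambda1 \<alpha>.
      Lambda1_norm \<alpha> p ((dual_conv \<alpha> b ^^ k) x) \<le> c k * K * Lambda1_norm \<alpha> q x"
proof -
  obtain q K where q: "1 \<le> q" and K: "0 < K"
      "\<And>n. (\<Sum>i\<le>n. weight p (Suc i) * weight r (Suc (n - i))) \<le> K * weight q (Suc n)"
    by (rule triangle_weight_bound[OF p r]) (rule that)
  show ?thesis
  proof (rule that[OF q K(1)], intro allI impI ballI)
    fix k :: nat and x :: "nat \<Rightarrow> 'a" assume k: "1 \<le> k" and x: "x \<in> Lambda1 \<alpha>"
    have "norm (conv_power b k n) \<le> c k * weight r (Suc n)" for n
      using decay[rule_format, OF k, of "Suc n"] by simp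
    from conv_adjoint_norm_le[OF q K(2) c this x]
    show "Lambda1_norm \<alpha> p ((dual_conv \<alpha> b ^^ k) x) \<le> c k * K * Lambda1_norm \<alpha> q x"
      by (simp add: dual_conv_funpow[OF b x])
  qed
qed

text \<open>
  Test the bound on \<open>e\<^sub>n\<close>: the first coordinate of its image is the entry of index \<open>n - 1\<close> of the
  convolution power.
\<close>

lemma iterate_bound_imp_conv_power_decay:
  fixes b :: "nat \<Rightarrow> 'a::{real_normed_field,banach}"
  assumes b: "b \<in> Lambda1_dual \<alpha>" and n: "1 \<le> n"
    and bound: "\<forall>x\<in>Lambda1 \<alpha>.
      Lambda1_norm \<alpha> 1 ((dual_conv \<alpha> b ^^ k) x) \<le> c * Lambda1_norm \<alpha> q x"
  shows "norm (conv_power b k (n - 1)) \<le> exp (\<alpha> 1) * c * weight q n"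
proof -
  let ?e = "canonical_basis n :: nat \<Rightarrow> 'a"
  have e: "?e \<in> Lambda1 \<alpha>" by (rule canonical_basis_in_Lambda1[OF n])
  have "norm (conv_power b k (n - 1)) * weight 1 1
      = norm (conv_adjoint (conv_power b k) ?e 1) * weight 1 1"
    by (simp only: conv_adjoint_canonical_basis_first[OF n])
  also have "\<dots> \<le> Lambda1_norm \<alpha> 1 (conv_adjoint (conv_power b k) ?e)"
    by (intro coordinate_le_Lambda1_norm conv_adjoint_in_Lambda1 conv_power_in_dual b e order.refl)
  also have "\<dots> \<le> c * weight q n"
    using bound[rule_format, OF e]
    by (simp add: dual_conv_funpow[OF b e] Lambda1_norm_canonical_basis[OF n])
  finally show ?thesis by (simp add: exp_minus field_simps)
qed

theorem m_topologizable_dual_conv_iff: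
  fixes b :: "nat \<Rightarrow> 'a::{real_normed_field,banach}"
  assumes b: "b \<in> Lambda1_dual \<alpha>"
  shows "m_topologizable (Lambda1 \<alpha>) (Lambda1_norm \<alpha>) (dual_conv \<alpha> b) \<longleftrightarrow>
    (\<exists>q\<ge>(1::nat). \<exists>D>0. \<forall>k\<ge>1. \<forall>n\<ge>1. norm (conv_power b k (n - 1)) \<le> D ^ k * weight q n)"
    (is "?L \<longleftrightarrow> ?R")
proof
  assume ?L
  then obtain q C where q: "1 \<le> q" and C: "1 \<le> C"
    and le: "\<forall>k\<ge>1. \<forall>x\<in>Lambda1 \<alpha>.
      Lambda1_norm \<alpha> 1 ((dual_conv \<alpha> b ^^ k) x) \<le> C ^ k * Lambda1_norm \<alpha> q x"
    unfolding m_topologizable_def by blast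
  have "norm (conv_power b k (n - 1)) \<le> (exp (\<alpha> 1) * C) ^ k * weight q n"
    if k: "1 \<le> k" and n: "1 \<le> n" for k n :: nat
  proof -
    have "norm (conv_power b k (n - 1)) \<le> exp (\<alpha> 1) * C ^ k * weight q n"
      using iterate_bound_imp_conv_power_decay[OF b n] le k by blast
    also have "\<dots> \<le> (exp (\<alpha> 1) * C) ^ k * weight q n"
      unfolding power_mult_distrib using C k nonneg[of 1]
      by (intro mult_right_mono self_le_power) auto
    finally show ?thesis .
  qed
  moreover have "0 < exp (\<alpha> 1) * C" using C by simp
  ultimately show ?R using q by blast
next
  assume ?R
  then obtain r D where r: "1 \<le> r" and D: "0 < D"
    and decay: "\<forall>k\<ge>1. \<forall>n\<ge>1. norm (conv_power b k (n - 1)) \<le> D ^ k * weight r n"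
    by blast
  have "\<exists>q\<ge>1. \<exists>C\<ge>1. \<forall>k\<ge>1. \<forall>x\<in>Lambda1 \<alpha>.
      Lambda1_norm \<alpha> p ((dual_conv \<alpha> b ^^ k) x) \<le> C ^ k * Lambda1_norm \<alpha> q x"
    if p: "1 \<le> p" for p
  proof -
    obtain q K where q: "1 \<le> q" and K: "0 < K"
      and le: "\<forall>k\<ge>1. \<forall>x\<in>Lambda1 \<alpha>.
        Lambda1_norm \<alpha> p ((dual_conv \<alpha> b ^^ k) x) \<le> D ^ k * K * Lambda1_norm \<alpha> q x"
      by (rule conv_power_decay_imp_iterate_bound[OF b p r _ decay]) (use D in simp, rule that)
    \<comment> \<open>As \<open>k \<ge> 1\<close>, the single factor \<open>K\<close> can be absorbed into the base of the power.\<close>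
    define C where "C = max 1 D * max 1 K"
    have "Lambda1_norm \<alpha> p ((dual_conv \<alpha> b ^^ k) x) \<le> C ^ k * Lambda1_norm \<alpha> q x"
      if k: "1 \<le> k" and x: "x \<in> Lambda1 \<alpha>" for k x
    proof -
      have "K \<le> max 1 K ^ k"
        using self_le_power[of "max 1 K" k] k by simp
      then have "D ^ k * K \<le> C ^ k"
        unfolding C_def power_mult_distrib using D K by (intro mult_mono power_mono) auto
      then show ?thesis
        using le[rule_format, OF k x] mult_right_mono[OF _ Lambda1_norm_nonneg[OF x q]] by (meson order.trans)
    qed
    moreover have "1 \<le> C" unfolding C_def using mult_mono[of 1 "max 1 D" 1 "max 1 K"] by simp
    ultimately show ?thesis using q by blast
  qed
  then show ?L
    unfolding m_topologizable_def using continuous_linear_operator_dual_conv[OF b] by blast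
qed

theorem power_bounded_dual_conv_iff:
  fixes b :: "nat \<Rightarrow> 'a::{real_normed_field,banach}"
  assumes b: "b \<in> Lambda1_dual \<alpha>"
  shows "power_bounded (Lambda1 \<alpha>) (Lambda1_norm \<alpha>) (dual_conv \<alpha> b) \<longleftrightarrow>
    (\<exists>q\<ge>(1::nat). \<exists>C\<ge>1. \<forall>k\<ge>1. \<forall>n\<ge>1. norm (conv_power b k (n - 1)) \<le> C * weight q n)"
    (is "?L \<longleftrightarrow> ?R")
proof
  assume ?L
  then obtain q C where q: "1 \<le> q" and C: "1 \<le> C"
    and le: "\<forall>k\<ge>1. \<forall>x\<in>Lambda1 \<alpha>.
      Lambda1_norm \<alpha> 1 ((dual_conv \<alpha> b ^^ k) x) \<le> C * Lambda1_norm \<alpha> q x"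
    unfolding power_bounded_def by blast
  have "norm (conv_power b k (n - 1)) \<le> (exp (\<alpha> 1) * C) * weight q n"
    if "1 \<le> k" and n: "1 \<le> n" for k n :: nat
    using iterate_bound_imp_conv_power_decay[OF b n] le that by blast
  moreover have "1 \<le> exp (\<alpha> 1) * C"
    using mult_mono[of 1 "exp (\<alpha> 1)" 1 C] C nonneg[of 1] by simp
  ultimately show ?R using q by blast
next
  assume ?R
  then obtain r D where r: "1 \<le> r" and D: "1 \<le> D"
    and decay: "\<forall>k\<ge>1. \<forall>n\<ge>1. norm (conv_power b k (n - 1)) \<le> D * weight r n"
    by blast
  have "\<exists>q\<ge>1. \<exists>C\<ge>1. \<forall>k\<ge>1. \<forall>x\<in>Lambda1 \<alpha>.
      Lambda1_norm \<alpha> p ((dual_conv \<alpha> b ^^ k) x) \<le> C * Lambda1_norm \<alpha> q x"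
    if p: "1 \<le> p" for p
  proof -
    obtain q K where q: "1 \<le> q" and K: "0 < K"
      and le: "\<forall>k\<ge>1. \<forall>x\<in>Lambda1 \<alpha>.
        Lambda1_norm \<alpha> p ((dual_conv \<alpha> b ^^ k) x) \<le> D * K * Lambda1_norm \<alpha> q x"
      by (rule conv_power_decay_imp_iterate_bound[OF b p r _ decay]) (use D in simp, rule that)
    have "Lambda1_norm \<alpha> p ((dual_conv \<alpha> b ^^ k) x) \<le> max 1 (D * K) * Lambda1_norm \<alpha> q x"
      if k: "1 \<le> k" and x: "x \<in> Lambda1 \<alpha>" for k x
      using le[rule_format, OF k x] mult_right_mono[OF max.cobounded2 Lambda1_norm_nonneg[OF x q]]
      by (meson order.trans)
    then show ?thesis using q by (meson max.cobounded1)
  qed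
  then show ?L
    unfolding power_bounded_def using continuous_linear_operator_dual_conv[OF b] by blast
qed

end

theorem theorem5p5:
  fixes \<alpha> :: "nat \<Rightarrow> real" and \<beta> :: "nat \<Rightarrow> 'a::{real_normed_field,banach}"
  assumes "\<And>n. n \<ge> 1 \<Longrightarrow> 0 \<le> \<alpha> n"
    and "mono_on {1..} \<alpha>"
    and "filterlim \<alpha> at_top sequentially"
    and "stable_sequence \<alpha>"
    and "nuclear_space (Lambda1 \<alpha> :: (nat \<Rightarrow> 'a) set) (Lambda1_norm \<alpha>)"
    and "\<beta> \<in> Lambda1_dual \<alpha>"
  shows "(m_topologizable (Lambda1 \<alpha>) (Lambda1_norm \<alpha>) (dual_conv \<alpha> \<beta>) \<longleftrightarrow>
      (\<forall>p\<ge>(1::nat). \<exists>q\<ge>(1::nat). \<exists>D>0. \<forall>k\<ge>1. \<forall>n\<ge>1.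
        norm (conv_power \<beta> k (n - 1)) \<le> D ^ k * exp (- (1 / real q) * \<alpha> n))) \<and>
    (power_bounded (Lambda1 \<alpha>) (Lambda1_norm \<alpha>) (dual_conv \<alpha> \<beta>) \<longleftrightarrow>
      (\<forall>p\<ge>(1::nat). \<exists>q\<ge>(1::nat). \<exists>C\<ge>1. \<forall>k\<ge>1. \<forall>n\<ge>1.
        norm (conv_power \<beta> k (n - 1)) \<le> C * exp (- (1 / real q) * \<alpha> n)))"
proof -
  obtain S A where "1 \<le> S" and "\<forall>n\<ge>1. \<alpha> (2 * n) \<le> S * \<alpha> n + A"
    by (rule stable_sequence_doubling[OF _ assms(3,4)]) (use assms(1) in simp, rule that)
  then interpret stable_nuclear_weight \<alpha> S A
    using assms(1,2) nuclear_Lambda1_summable_weights[OF assms(1,5)]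
    by unfold_locales (auto simp: mono_on_def)
  have const: "(\<forall>p\<ge>(1::nat). P) \<longleftrightarrow> P" for P by auto
  show ?thesis
    unfolding const m_topologizable_dual_conv_iff[OF assms(6)] power_bounded_dual_conv_iff[OF assms(6)]
    by (intro conjI refl)
qed

end
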